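(* Let $a,b$ be odd positive integers. For every positive integer $n$, $$t(a,3a,2b;n)=\frac 23N(a,3a,2b;8n+4a+2b).$$
   Context: For positive integers $a_1,\dots,a_k$ and a nonnegative integer $n$, $N(a_1,\dots,a_k;n)$ is the number of $(x_1,\dots,x_k)\in\mathbb Z^k$ with $n=a_1x_1^2+\cdots+a_kx_k^2$, and $t(a_1,\dots,a_k;n)$ is the number of $(x_1,\dots,x_k)\in\mathbb Z^k$ with $n=a_1\frac{x_1(x_1-1)}2+\cdots+a_k\frac{x_k(x_k-1)}2$. *)

theory Defs
  imports Complex_Main
begin

text \<open>The coefficients \<open>a\<^sub>1, \<dots>, a\<^sub>k\<close> form a list, and a tuple in \<open>\<int>\<^sup>k\<close> is an integer
  list of the same length. Both solution sets are finite when all coefficients are positive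
  (lemmas below), so that \<open>card\<close> is the actual number of representations.\<close>

definition square_reps :: "nat list \<Rightarrow> nat \<Rightarrow> int list set" where
  "square_reps as n =
     {xs. length xs = length as \<and> int n = (\<Sum>i<length as. int (as ! i) * (xs ! i)\<^sup>2)}"

definition N_reps :: "nat list \<Rightarrow> nat \<Rightarrow> nat" where
  "N_reps as n = card (square_reps as n)"

text \<open>The integer division by 2 is exact, since \<open>x (x - 1)\<close> is even.\<close>

definition triangular_reps :: "nat list \<Rightarrow> nat \<Rightarrow> int list set" where
  "triangular_reps as n =
     {xs. length xs = length as \<and>
          int n = (\<Sum>i<length as. int (as ! i) * (xs ! i * (xs ! i - 1) div 2))}"

definition t_reps :: "nat list \<Rightarrow> nat \<Rightarrow> nat" where
  "t_reps as n = card (triangular_reps as n)"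

lemma finite_reps_aux:
  fixes g :: "int \<Rightarrow> int" and as :: "nat list" and n :: nat
  assumes pos: "\<And>a. a \<in> set as \<Longrightarrow> 0 < a"
    and g: "\<And>x. \<bar>x\<bar> \<le> g x + 1" "\<And>x. 0 \<le> g x"
  shows "finite {xs. length xs = length as \<and> int n = (\<Sum>i<length as. int (as ! i) * g (xs ! i))}"
    (is "finite ?S")
proof (rule finite_subset)
  show "finite {xs. set xs \<subseteq> {- int n - 1..int n + 1} \<and> length xs = length as}"
    by (intro finite_lists_length_eq) simp
  show "?S \<subseteq> {xs. set xs \<subseteq> {- int n - 1..int n + 1} \<and> length xs = length as}"
  proof safe
    fix xs :: "int list" and x
    assume len: "length xs = length as"
      and n: "int n = (\<Sum>i<length as. int (as ! i) * g (xs ! i))" and x: "x \<in> set xs"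
    from x len obtain j where j: "j < length as" "x = xs ! j"
      by (metis in_set_conv_nth)
    have "1 \<le> int (as ! j)"
      using pos[of "as ! j"] j by simp
    then have "1 * g x \<le> int (as ! j) * g x"
      using g(2) by (intro mult_right_mono) auto
    also have "\<dots> \<le> (\<Sum>i<length as. int (as ! i) * g (xs ! i))"
      unfolding j(2) by (rule member_le_sum) (use j g(2) in auto)
    finally have "g x \<le> int n"
      using n by simp
    with g(1)[of x] show "x \<in> {- int n - 1..int n + 1}"
      by auto
  qed
qed

lemma finite_square_reps:
  assumes "\<And>a. a \<in> set as \<Longrightarrow> 0 < a"
  shows "finite (square_reps as n)"
  unfolding square_reps_def
proof (rule finite_reps_aux[OF assms])
  show "\<bar>x\<bar> \<le> x\<^sup>2 + 1" for x :: int
  proof (cases "x = 0")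
    case False
    then have "\<bar>x\<bar> \<le> x\<^sup>2"
      using self_le_power[of "\<bar>x\<bar>" 2] by simp
    then show ?thesis by linarith
  qed simp
qed auto

lemma finite_triangular_reps:
  assumes "\<And>a. a \<in> set as \<Longrightarrow> 0 < a"
  shows "finite (triangular_reps as n)"
  unfolding triangular_reps_def
proof (rule finite_reps_aux[OF assms])
  fix x :: int
  show "0 \<le> x * (x - 1) div 2"
    by (cases "x \<le> 0") (auto simp: mult_nonpos_nonpos)
  have "2 * \<bar>x\<bar> - 2 \<le> x * (x - 1)"
  proof -
    have "x \<le> -1 \<or> x = 0 \<or> x = 1 \<or> 2 \<le> x" by linarith
    moreover have "2 * \<bar>x\<bar> - 2 \<le> x * (x - 1)" if "x \<le> -1"
      using mult_left_mono_neg[of "x - 1" "-2" x] that by simp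
    moreover have "2 * \<bar>x\<bar> - 2 \<le> x * (x - 1)" if "2 \<le> x"
      using mult_right_mono[of 2 x "x - 1"] that by simp
    ultimately show ?thesis by auto
  qed
  then show "\<bar>x\<bar> \<le> x * (x - 1) div 2 + 1"
    by linarith
qed auto

end

theory Submission
  imports Defs
begin

text \<open>Completing the square, \<open>t(a\<^sub>1, \<dots>, a\<^sub>k; n)\<close> counts the representations of
  \<open>8n + a\<^sub>1 + \<dots> + a\<^sub>k\<close> by \<open>a\<^sub>1x\<^sub>1\<^sup>2 + \<dots> + a\<^sub>kx\<^sub>k\<^sup>2\<close> with all \<open>x\<^sub>i\<close> odd. If
  \<open>a(x\<^sup>2 + 3y\<^sup>2) + 2bz\<^sup>2 = 8n + 4a + 2b\<close>, then \<open>z\<close> is odd and \<open>x\<^sup>2 + 3y\<^sup>2 \<equiv> 4 (mod 8)\<close>, so it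
  suffices to show that two thirds of the representations of any \<open>m \<equiv> 4 (mod 8)\<close> as
  \<open>x\<^sup>2 + 3y\<^sup>2\<close> are odd. The odd ones split according to whether \<open>4\<close> divides \<open>x - y\<close> or \<open>x + y\<close>,
  and the sign change of \<open>y\<close> exchanges the two halves. Conjugation of \<open>x + y\<surd>-3\<close> followed by
  multiplication by the sixth root of unity \<open>(1 + \<surd>-3)/2\<close> preserves \<open>x\<^sup>2 + 3y\<^sup>2\<close> and exchanges
  the even representations with the odd ones for which \<open>4\<close> divides \<open>x - y\<close>.\<close>

definition odd_square_reps :: "nat list \<Rightarrow> nat \<Rightarrow> int list set" where
  "odd_square_reps as n = {xs \<in> square_reps as n. \<forall>x\<in>set xs. odd x}"

lemma square_two_mult_minus_one:
  fixes x :: int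
  shows "(2 * x - 1)\<^sup>2 = 8 * (x * (x - 1) div 2) + 1"
proof -
  have "even (x * (x - 1))" by simp
  then obtain k where "x * (x - 1) = 2 * k" by (rule evenE)
  then show ?thesis by (simp add: power2_eq_square algebra_simps)
qed

lemma map_two_mult_minus_one_in_square_reps_iff:
  "map (\<lambda>x. 2 * x - 1) xs \<in> square_reps as (8 * n + sum_list as) \<longleftrightarrow> xs \<in> triangular_reps as n"
proof (cases "length xs = length as")
  case True
  let ?T = "\<Sum>i<length as. int (as ! i) * (xs ! i * (xs ! i - 1) div 2)"
  have "(\<Sum>i<length as. int (as ! i) * (map (\<lambda>x. 2 * x - 1) xs ! i)\<^sup>2)
      = (\<Sum>i<length as. 8 * (int (as ! i) * (xs ! i * (xs ! i - 1) div 2)) + int (as ! i))"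
    using True by (intro sum.cong) (simp_all add: square_two_mult_minus_one distrib_left)
  also have "\<dots> = 8 * ?T + int (sum_list as)"
    by (simp add: sum.distrib sum_distrib_left sum_list_sum_nth atLeast0LessThan)
  finally show ?thesis
    using True by (simp add: square_reps_def triangular_reps_def)
qed (simp add: square_reps_def triangular_reps_def)

lemma t_reps_eq_card_odd_square_reps:
  "t_reps as n = card (odd_square_reps as (8 * n + sum_list as))"
proof -
  let ?f = "map (\<lambda>x::int. 2 * x - 1)" and ?g = "map (\<lambda>y::int. (y + 1) div 2)"
  have inverse_on_odd: "?f (?g ys) = ys" if "\<forall>y\<in>set ys. odd y" for ys
    using that by (auto intro!: map_idI elim!: oddE)
  have "bij_betw ?f (triangular_reps as n) (odd_square_reps as (8 * n + sum_list as))"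
  proof (rule bij_betw_byWitness[where f' = ?g])
    show "\<forall>xs\<in>triangular_reps as n. ?g (?f xs) = xs"
      by (simp add: o_def)
    show "\<forall>ys\<in>odd_square_reps as (8 * n + sum_list as). ?f (?g ys) = ys"
      using inverse_on_odd by (simp add: odd_square_reps_def)
    show "?f ` triangular_reps as n \<subseteq> odd_square_reps as (8 * n + sum_list as)"
      by (auto simp: odd_square_reps_def map_two_mult_minus_one_in_square_reps_iff)
    show "?g ` odd_square_reps as (8 * n + sum_list as) \<subseteq> triangular_reps as n"
    proof (rule image_subsetI)
      fix ys assume "ys \<in> odd_square_reps as (8 * n + sum_list as)"
      then have "?f (?g ys) \<in> square_reps as (8 * n + sum_list as)"
        using inverse_on_odd[of ys] by (simp add: odd_square_reps_def del: map_map)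
      then show "?g ys \<in> triangular_reps as n"
        by (simp only: map_two_mult_minus_one_in_square_reps_iff)
    qed
  qed
  then show ?thesis
    unfolding t_reps_def by (rule bij_betw_same_card)
qed

definition norm_form :: "int \<Rightarrow> int \<Rightarrow> int" where
  "norm_form x y = x\<^sup>2 + 3 * y\<^sup>2"

definition norm_reps :: "int \<Rightarrow> (int \<times> int) set" where
  "norm_reps m = {(x, y). norm_form x y = m}"

lemma finite_norm_reps: "finite (norm_reps m)"
proof (rule finite_surj)
  show "finite (square_reps [1, 3] (nat m))"
    by (rule finite_square_reps) auto
  show "norm_reps m \<subseteq> (\<lambda>xs. (xs ! 0, xs ! 1)) ` square_reps [1, 3] (nat m)"
  proof clarify
    fix x y assume "(x, y) \<in> norm_reps m"
    then have "[x, y] \<in> square_reps [1, 3] (nat m)"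
      by (auto simp: norm_reps_def norm_form_def square_reps_def)
    then show "(x, y) \<in> (\<lambda>xs. (xs ! 0, xs ! 1)) ` square_reps [1, 3] (nat m)"
      by (rule rev_image_eqI) simp
  qed
qed

lemma even_norm_form_iff: "even (norm_form x y) \<longleftrightarrow> (even x \<longleftrightarrow> even y)"
  by (simp add: norm_form_def)

lemma four_dvd_norm_form:
  assumes "even (norm_form x y)"
  shows "4 dvd norm_form x y"
proof -
  have "even (x - y)"
    using assms by (simp add: even_norm_form_iff)
  then obtain w where "x - y = 2 * w" by (rule evenE)
  then have "x = y + 2 * w" by simp
  then have "norm_form x y = 4 * (y\<^sup>2 + y * w + w\<^sup>2)"
    by (simp add: norm_form_def power2_eq_square algebra_simps)
  then show ?thesis by simp
qed

definition reflection :: "int \<times> int \<Rightarrow> int \<times> int" where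
  "reflection = (\<lambda>(x, y). ((x + 3 * y) div 2, (x - y) div 2))"

lemma
  assumes "even m" "p \<in> norm_reps m"
  shows reflection_in_norm_reps: "reflection p \<in> norm_reps m"
    and reflection_reflection: "reflection (reflection p) = p"
proof -
  obtain x y where p: "p = (x, y)" by fastforce
  have "even (x - y)"
    using assms even_norm_form_iff[of x y] by (simp add: p norm_reps_def)
  then obtain w where "x - y = 2 * w" by (rule evenE)
  then have x: "x = y + 2 * w" by simp
  have reflection_eq: "reflection p = (2 * y + w, w)"
    by (simp add: reflection_def p x)
  show "reflection (reflection p) = p"
    unfolding reflection_eq by (simp add: reflection_def p x)
  show "reflection p \<in> norm_reps m"
    unfolding reflection_eq using assms(2)
    by (simp add: p x norm_reps_def norm_form_def power2_eq_square algebra_simps)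
qed

lemma odd_reflection_if_even:
  assumes m: "m mod 8 = 4" and xy: "(x, y) \<in> norm_reps m" and "even x"
    and reflection_eq: "(x', y') = reflection (x, y)"
  shows "odd x'" and "4 dvd x' - y'"
proof -
  have norm: "norm_form x y = m" using xy by (simp add: norm_reps_def)
  have "even m" using m by presburger
  then have "even y" using \<open>even x\<close> norm even_norm_form_iff[of x y] by simp
  with \<open>even x\<close> obtain u v where uv: "x = 2 * u" "y = 2 * v" by (elim evenE)
  have "4 * norm_form u v = m"
    using norm by (simp add: uv norm_form_def power2_eq_square)
  then have "odd (norm_form u v)" using m by presburger
  then have "odd (u + 3 * v)" by (simp add: even_norm_form_iff)
  moreover have "x' = u + 3 * v" "y' = u - v"
    using reflection_eq by (simp_all add: uv reflection_def)
  ultimately show "odd x'" "4 dvd x' - y'" by simp_all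
qed

lemma even_reflection_if_four_dvd:
  assumes "4 dvd x - y" and reflection_eq: "(x', y') = reflection (x, y)"
  shows "even x'"
proof -
  obtain k where "x - y = 4 * k" using assms(1) by (rule dvdE)
  then have "x = y + 4 * k" by simp
  then have "x' = 2 * (y + k)" using reflection_eq by (simp add: reflection_def)
  then show ?thesis by simp
qed

lemma card_even_norm_reps_eq:
  assumes m: "m mod 8 = 4"
  shows "card {(x, y) \<in> norm_reps m. even x} = card {(x, y) \<in> norm_reps m. odd x \<and> 4 dvd x - y}"
    (is "card ?E = card ?D")
proof (rule bij_betw_same_card, rule bij_betw_byWitness[where f' = reflection])
  have "even m" using m by presburger
  note preserves = reflection_in_norm_reps[OF this] and involutive = reflection_reflection[OF this]
  show "\<forall>p\<in>?E. reflection (reflection p) = p" "\<forall>p\<in>?D. reflection (reflection p) = p"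
    using involutive by auto
  show "reflection ` ?E \<subseteq> ?D"
  proof clarify
    fix x y x' y' assume "(x, y) \<in> norm_reps m" "even x" "(x', y') = reflection (x, y)"
    then show "(x', y') \<in> norm_reps m \<and> odd x' \<and> 4 dvd x' - y'"
      using preserves odd_reflection_if_even[OF m] by metis
  qed
  show "reflection ` ?D \<subseteq> ?E"
  proof clarify
    fix x y x' y' assume "(x, y) \<in> norm_reps m" "4 dvd x - y" "(x', y') = reflection (x, y)"
    then show "(x', y') \<in> norm_reps m \<and> even x'"
      using preserves even_reflection_if_four_dvd by metis
  qed
qed

lemma card_norm_reps_four_dvd_diff_eq_add:
  "card {(x, y) \<in> norm_reps m. odd x \<and> 4 dvd x - y} = card {(x, y) \<in> norm_reps m. odd x \<and> 4 dvd x + y}"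
  by (rule bij_betw_same_card[of "\<lambda>(x, y). (x, - y)"],
      rule bij_betw_byWitness[where f' = "\<lambda>(x, y). (x, - y)"])
    (auto simp: norm_reps_def norm_form_def)

lemma card_odd_norm_reps:
  assumes m: "m mod 8 = 4"
  shows "3 * card {(x, y) \<in> norm_reps m. odd x} = 2 * card (norm_reps m)"
proof -
  let ?E = "{(x, y) \<in> norm_reps m. even x}" and ?O = "{(x, y) \<in> norm_reps m. odd x}"
  let ?D = "{(x, y) \<in> norm_reps m. odd x \<and> 4 dvd x - y}"
  let ?D' = "{(x, y) \<in> norm_reps m. odd x \<and> 4 dvd x + y}"
  have fin: "finite {(x, y) \<in> norm_reps m. P x y}" for P
    by (rule finite_subset[OF _ finite_norm_reps[of m]]) auto
  have "even m" using m by presburger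
  then have odd_y: "odd y" if "(x, y) \<in> norm_reps m" "odd x" for x y
    using that even_norm_form_iff[of x y] by (simp add: norm_reps_def)
  have four_dvd: "4 dvd x - y \<longleftrightarrow> \<not> 4 dvd x + y" if "odd x" "odd y" for x y :: int
    using that by presburger
  have "?O = ?D \<union> ?D'" "?D \<inter> ?D' = {}"
    using odd_y four_dvd by auto
  then have "card ?O = card ?D + card ?D'"
    using fin by (simp add: card_Un_disjoint)
  then have "card ?O = 2 * card ?E"
    using card_even_norm_reps_eq[OF m] card_norm_reps_four_dvd_diff_eq_add[of m] by simp
  moreover have "card (norm_reps m) = card ?E + card ?O"
  proof -
    have "norm_reps m = ?E \<union> ?O" by auto
    also have "card \<dots> = card ?E + card ?O"
      by (rule card_Un_disjoint) (use fin in auto)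
    finally show ?thesis .
  qed
  ultimately show ?thesis by simp
qed

lemma card_filter_proportional_fibers:
  fixes g :: "'a \<Rightarrow> 'b" and p q :: nat
  assumes "finite S"
    and fibers: "\<And>z. z \<in> g ` S \<Longrightarrow> p * card {x \<in> S. P x \<and> g x = z} = q * card {x \<in> S. g x = z}"
  shows "p * card {x \<in> S. P x} = q * card S"
proof -
  have count: "card {x \<in> S. Q x} = (\<Sum>z\<in>g ` S. card {x \<in> S. Q x \<and> g x = z})" for Q
    using sum.group[of "{x \<in> S. Q x}" "g ` S" g "\<lambda>_. 1 :: nat"] \<open>finite S\<close>
    by (simp add: image_mono)
  show ?thesis
    using count[of P] count[of "\<lambda>_. True"] fibers by (simp add: sum_distrib_left)
qed

lemma Cons_Cons_in_square_reps_iff: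
  "x # y # zs \<in> square_reps (a # b # cs) n \<longleftrightarrow> length zs = length cs \<and>
     int n = int a * x\<^sup>2 + int b * y\<^sup>2 + (\<Sum>i<length cs. int (cs ! i) * (zs ! i)\<^sup>2)"
  unfolding square_reps_def by (simp add: sum.lessThan_Suc_shift add.assoc del: sum.lessThan_Suc)

lemma square_reps_fiber:
  assumes "0 < a" and rep: "x # y # zs \<in> square_reps (a # 3 * a # cs) n"
  shows "{xs \<in> square_reps (a # 3 * a # cs) n. P (hd xs) \<and> drop 2 xs = zs}
    = (\<lambda>(x', y'). x' # y' # zs) ` {(x', y') \<in> norm_reps (norm_form x y). P x'}"
    (is "?F = ?f ` ?R")
proof -
  have fiber_iff: "x' # y' # zs \<in> square_reps (a # 3 * a # cs) n \<longleftrightarrow>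
      norm_form x' y' = norm_form x y" for x' y'
  proof -
    have "x' # y' # zs \<in> square_reps (a # 3 * a # cs) n \<longleftrightarrow>
        int a * norm_form x' y' = int a * norm_form x y"
      using rep by (auto simp: Cons_Cons_in_square_reps_iff norm_form_def algebra_simps)
    then show ?thesis using \<open>0 < a\<close> by simp
  qed
  show ?thesis
  proof (intro equalityI subsetI)
    fix xs assume xs: "xs \<in> ?F"
    then obtain x' y' where "xs = x' # y' # zs"
      by (auto simp: square_reps_def length_Suc_conv)
    with xs fiber_iff show "xs \<in> ?f ` ?R"
      by (auto simp: norm_reps_def)
  next
    fix xs assume "xs \<in> ?f ` ?R"
    then show "xs \<in> ?F" using fiber_iff by (auto simp: norm_reps_def)
  qed
qed

lemma card_square_reps_odd_hd:
  assumes "0 < a" and fin: "finite (square_reps (a # 3 * a # cs) n)"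
    and norm: "\<And>x y zs. x # y # zs \<in> square_reps (a # 3 * a # cs) n \<Longrightarrow> norm_form x y mod 8 = 4"
  shows "3 * card {xs \<in> square_reps (a # 3 * a # cs) n. odd (hd xs)} = 2 * N_reps (a # 3 * a # cs) n"
  unfolding N_reps_def
proof (rule card_filter_proportional_fibers[where g = "drop 2", OF fin])
  fix zs assume "zs \<in> drop 2 ` square_reps (a # 3 * a # cs) n"
  then obtain x y where rep: "x # y # zs \<in> square_reps (a # 3 * a # cs) n"
    by (auto simp: square_reps_def length_Suc_conv)
  have card_fiber: "card {xs \<in> square_reps (a # 3 * a # cs) n. P (hd xs) \<and> drop 2 xs = zs}
      = card {(x', y') \<in> norm_reps (norm_form x y). P x'}" for P
    unfolding square_reps_fiber[OF \<open>0 < a\<close> rep] by (rule card_image) (auto simp: inj_on_def)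
  show "3 * card {xs \<in> square_reps (a # 3 * a # cs) n. odd (hd xs) \<and> drop 2 xs = zs}
      = 2 * card {xs \<in> square_reps (a # 3 * a # cs) n. drop 2 xs = zs}"
    using card_fiber[of odd] card_fiber[of "\<lambda>_. True"] card_odd_norm_reps[OF norm[OF rep]] by simp
qed

lemma
  fixes a b n x y z :: int
  assumes "odd a" "odd b"
    and eq: "a * norm_form x y + 2 * b * z\<^sup>2 = 8 * n + 4 * a + 2 * b"
  shows norm_form_mod_8_eq_4: "norm_form x y mod 8 = 4" and odd_if_norm_form_add_eq: "odd z"
proof -
  have "a * norm_form x y = 2 * (4 * n + 2 * a + b - b * z\<^sup>2)"
    using eq by (simp add: algebra_simps)
  then have "even (a * norm_form x y)" by simp
  then have "4 dvd norm_form x y"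
    using \<open>odd a\<close> by (intro four_dvd_norm_form) simp
  then obtain q where "norm_form x y = 4 * q" by (rule dvdE)
  then have "b * z\<^sup>2 = 2 * (2 * n + a - a * q) + b"
    using eq by (simp add: algebra_simps)
  then have "odd (b * z\<^sup>2)" using \<open>odd b\<close> by simp
  then show "odd z" by simp
  then obtain j where "z = 2 * (j + 1) - 1" by (auto elim!: oddE)
  then obtain k where k: "z\<^sup>2 = 8 * k + 1" using square_two_mult_minus_one by blast
  have "a * (norm_form x y - 4) = 8 * (n - 2 * b * k)"
    using eq by (simp add: k algebra_simps)
  then have "8 dvd a * (norm_form x y - 4)" by simp
  moreover have "coprime 8 a"
    using \<open>odd a\<close> coprime_power_left_iff[of 2 3 a] by simp
  ultimately have "8 dvd norm_form x y - 4"
    by (simp add: coprime_dvd_mult_right_iff)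
  then show "norm_form x y mod 8 = 4" by presburger
qed

lemma ternary_square_reps_cases:
  assumes "odd a" "odd b" and rep: "xs \<in> square_reps [a, 3 * a, 2 * b] (8 * n + 4 * a + 2 * b)"
  obtains x y z where "xs = [x, y, z]" "norm_form x y mod 8 = 4" "odd z"
proof -
  obtain x y z where xs: "xs = [x, y, z]"
    using rep by (auto simp: square_reps_def length_Suc_conv)
  have eq: "int a * norm_form x y + 2 * int b * z\<^sup>2 = 8 * int n + 4 * int a + 2 * int b"
    using rep by (simp add: xs Cons_Cons_in_square_reps_iff norm_form_def algebra_simps)
  have "odd (int a)" "odd (int b)" using assms by simp_all
  then show thesis
    using that[OF xs] norm_form_mod_8_eq_4[OF _ _ eq] odd_if_norm_form_add_eq[OF _ _ eq] by blast
qed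

lemma ternary_odd_square_reps_eq:
  assumes "odd a" "odd b"
  shows "odd_square_reps [a, 3 * a, 2 * b] (8 * n + 4 * a + 2 * b)
    = {xs \<in> square_reps [a, 3 * a, 2 * b] (8 * n + 4 * a + 2 * b). odd (hd xs)}"
proof -
  have "(\<forall>x\<in>set xs. odd x) \<longleftrightarrow> odd (hd xs)"
    if rep: "xs \<in> square_reps [a, 3 * a, 2 * b] (8 * n + 4 * a + 2 * b)" for xs
  proof -
    obtain x y z where xyz: "xs = [x, y, z]" "norm_form x y mod 8 = 4" "odd z"
      using ternary_square_reps_cases[OF assms rep] .
    then have "even (norm_form x y)" by presburger
    then show ?thesis using xyz by (simp add: even_norm_form_iff)
  qed
  then show ?thesis by (auto simp: odd_square_reps_def)
qed

theorem theorem3p1: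
  fixes a b n :: nat
  assumes "odd a" and "odd b" and "0 < n"
  shows "real (t_reps [a, 3 * a, 2 * b] n) = 2 / 3 * real (N_reps [a, 3 * a, 2 * b] (8 * n + 4 * a + 2 * b))"
proof -
  let ?N = "8 * n + 4 * a + 2 * b"
  let ?S = "square_reps [a, 3 * a, 2 * b] ?N"
  have pos: "0 < a" "0 < b" using assms by (auto intro: odd_pos)
  have "t_reps [a, 3 * a, 2 * b] n = card {xs \<in> ?S. odd (hd xs)}"
    using t_reps_eq_card_odd_square_reps[of "[a, 3 * a, 2 * b]" n]
    unfolding ternary_odd_square_reps_eq[OF assms(1,2), symmetric] by (simp add: add.assoc)
  moreover have "3 * card {xs \<in> ?S. odd (hd xs)} = 2 * N_reps [a, 3 * a, 2 * b] ?N"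
  proof (rule card_square_reps_odd_hd)
    show "finite ?S"
      using pos by (intro finite_square_reps) auto
    show "norm_form x y mod 8 = 4" if "x # y # zs \<in> ?S" for x y zs
      using ternary_square_reps_cases[OF assms(1,2) that] by auto
  qed (rule pos)
  ultimately show ?thesis by simp
qed

end
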